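(* For any $m\in\mathbb N$ and $j<m$, there are first-order sentences $\varphi$ and $\psi$ in the language of dynamical systems such that for every sequence $\bar n=(n_k)_{k\in\omega}$ of natural numbers: (i) $\mathfrak A_{\bar n}\models\varphi$ if and only if $n_k\equiv j\pmod m$ for all but finitely many $k\in\omega$; (ii) $\mathfrak A_{\bar n}\models\psi$ if and only if $n_k\equiv j\pmod m$ for infinitely many $k\in\omega$.
   Context: The language of dynamical systems is the language of Boolean algebras expanded by one unary function symbol. For a sequence $\bar n=(n_k)$, let $I_k=[\sum_{i<k}n_i,\sum_{i\le k}n_i)$ be consecutive intervals of $\mathbb N$; the rotary permutation $r_{\bar n}$ cyclically permutes each $I_k$ ($i\mapsto i+1$ except $\max I_k\mapsto\min I_k$). $\alpha_{\bar n}([A]_{\mathrm{Fin}})=[r_{\bar n}[A]]_{\mathrm{Fin}}$ is an automorphism of $\mathcal P(\mathbb N)/\mathrm{Fin}$, and $\mathfrak A_{\bar n}=\langle\mathcal P(\mathbb N)/\mathrm{Fin},\alpha_{\bar n}\rangle$ with the function symbol interpreted as $\alpha_{\bar n}$. *)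

theory Defs
  imports "HOL-Library.Infinite_Set" "HOL-Number_Theory.Cong"
begin

section \<open>The language of dynamical systems\<close>

datatype ds_term =
    Var nat
  | Zero
  | One
  | Meet ds_term ds_term
  | Join ds_term ds_term
  | Compl ds_term
  | Fn ds_term

datatype ds_fm =
    Eq ds_term ds_term
  | Neg ds_fm
  | Conj ds_fm ds_fm
  | Disj ds_fm ds_fm
  | Imp ds_fm ds_fm
  | All nat ds_fm
  | Ex nat ds_fm

fun fv_term :: "ds_term \<Rightarrow> nat set" where
  "fv_term (Var x) = {x}"
| "fv_term Zero = {}"
| "fv_term One = {}"
| "fv_term (Meet s t) = fv_term s \<union> fv_term t"
| "fv_term (Join s t) = fv_term s \<union> fv_term t"
| "fv_term (Compl t) = fv_term t"
| "fv_term (Fn t) = fv_term t"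

fun fv :: "ds_fm \<Rightarrow> nat set" where
  "fv (Eq s t) = fv_term s \<union> fv_term t"
| "fv (Neg p) = fv p"
| "fv (Conj p q) = fv p \<union> fv q"
| "fv (Disj p q) = fv p \<union> fv q"
| "fv (Imp p q) = fv p \<union> fv q"
| "fv (All x p) = fv p - {x}"
| "fv (Ex x p) = fv p - {x}"

definition sentence :: "ds_fm \<Rightarrow> bool" where
  "sentence p \<longleftrightarrow> fv p = {}"

text \<open>A structure is a Boolean algebra, given as a type of class \<open>boolean_algebra\<close> whose
  universe is the whole type, together with the interpretation \<open>f\<close> of the function symbol.\<close>

fun eval_term :: "('a::boolean_algebra \<Rightarrow> 'a) \<Rightarrow> (nat \<Rightarrow> 'a) \<Rightarrow> ds_term \<Rightarrow> 'a" where
  "eval_term f v (Var x) = v x"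
| "eval_term f v Zero = bot"
| "eval_term f v One = top"
| "eval_term f v (Meet s t) = inf (eval_term f v s) (eval_term f v t)"
| "eval_term f v (Join s t) = sup (eval_term f v s) (eval_term f v t)"
| "eval_term f v (Compl t) = - eval_term f v t"
| "eval_term f v (Fn t) = f (eval_term f v t)"

fun sat :: "('a::boolean_algebra \<Rightarrow> 'a) \<Rightarrow> (nat \<Rightarrow> 'a) \<Rightarrow> ds_fm \<Rightarrow> bool" where
  "sat f v (Eq s t) \<longleftrightarrow> eval_term f v s = eval_term f v t"
| "sat f v (Neg p) \<longleftrightarrow> \<not> sat f v p"
| "sat f v (Conj p q) \<longleftrightarrow> sat f v p \<and> sat f v q"
| "sat f v (Disj p q) \<longleftrightarrow> sat f v p \<or> sat f v q"
| "sat f v (Imp p q) \<longleftrightarrow> (sat f v p \<longrightarrow> sat f v q)"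
| "sat f v (All x p) \<longleftrightarrow> (\<forall>a. sat f (v(x := a)) p)"
| "sat f v (Ex x p) \<longleftrightarrow> (\<exists>a. sat f (v(x := a)) p)"

definition models :: "('a::boolean_algebra \<Rightarrow> 'a) \<Rightarrow> ds_fm \<Rightarrow> bool" where
  "models f p \<longleftrightarrow> (\<forall>v. sat f v p)"


section \<open>The Boolean algebra of sets of natural numbers modulo finite sets\<close>

definition eq_fin :: "nat set \<Rightarrow> nat set \<Rightarrow> bool" where
  "eq_fin A B \<longleftrightarrow> finite (sym_diff A B)"

lemma equivp_eq_fin: "equivp eq_fin"
proof (rule equivpI)
  show "reflp eq_fin" by (auto simp: reflp_def eq_fin_def)
  show "symp eq_fin" by (auto simp: symp_def eq_fin_def)
  show "transp eq_fin"
  proof (rule transpI)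
    fix A B C assume "eq_fin A B" "eq_fin B C"
    then have "finite (sym_diff A B \<union> sym_diff B C)" by (simp add: eq_fin_def)
    then show "eq_fin A C" unfolding eq_fin_def by (rule finite_subset[rotated]) auto
  qed
qed

quotient_type pnat_fin = "nat set" / eq_fin
  by (rule equivp_eq_fin)

instantiation pnat_fin :: boolean_algebra
begin

lift_definition bot_pnat_fin :: pnat_fin is "{}" .

lift_definition top_pnat_fin :: pnat_fin is "UNIV" .

lift_definition inf_pnat_fin :: "pnat_fin \<Rightarrow> pnat_fin \<Rightarrow> pnat_fin" is "(\<inter>)"
  unfolding eq_fin_def
  subgoal for A B C D
    by (rule finite_subset[of _ "sym_diff A B \<union> sym_diff C D"]) auto
  done

lift_definition sup_pnat_fin :: "pnat_fin \<Rightarrow> pnat_fin \<Rightarrow> pnat_fin" is "(\<union>)"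
  unfolding eq_fin_def
  subgoal for A B C D
    by (rule finite_subset[of _ "sym_diff A B \<union> sym_diff C D"]) auto
  done

lift_definition uminus_pnat_fin :: "pnat_fin \<Rightarrow> pnat_fin" is "uminus"
  unfolding eq_fin_def
  subgoal for A B
    by (rule finite_subset[of _ "sym_diff A B"]) auto
  done

lift_definition minus_pnat_fin :: "pnat_fin \<Rightarrow> pnat_fin \<Rightarrow> pnat_fin" is "(-)"
  unfolding eq_fin_def
  subgoal for A B C D
    by (rule finite_subset[of _ "sym_diff A B \<union> sym_diff C D"]) auto
  done

lift_definition less_eq_pnat_fin :: "pnat_fin \<Rightarrow> pnat_fin \<Rightarrow> bool" is "\<lambda>A B. finite (A - B)"
proof -
  fix A B C D assume *: "eq_fin A B" "eq_fin C D"
  have "A - C \<subseteq> (B - D) \<union> (sym_diff A B \<union> sym_diff C D)"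
    and "B - D \<subseteq> (A - C) \<union> (sym_diff A B \<union> sym_diff C D)" by auto
  moreover have "finite (sym_diff A B \<union> sym_diff C D)" using * by (simp add: eq_fin_def)
  ultimately show "finite (A - C) = finite (B - D)"
    by (metis finite_UnI finite_subset)
qed

definition less_pnat_fin :: "pnat_fin \<Rightarrow> pnat_fin \<Rightarrow> bool" where
  "less_pnat_fin a b \<longleftrightarrow> a \<le> b \<and> \<not> b \<le> a"

instance
proof
  fix a b c :: pnat_fin
  show "(a < b) = (a \<le> b \<and> \<not> b \<le> a)" by (rule less_pnat_fin_def)
  show "a \<le> a" by transfer simp
  show "a \<le> b \<Longrightarrow> b \<le> c \<Longrightarrow> a \<le> c"
  proof transfer
    fix A B C :: "nat set" assume "finite (A - B)" "finite (B - C)"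
    then have "finite ((A - B) \<union> (B - C))" by simp
    then show "finite (A - C)" by (rule finite_subset[rotated]) blast
  qed
  show "a \<le> b \<Longrightarrow> b \<le> a \<Longrightarrow> a = b" by transfer (simp add: eq_fin_def)
  have sub: "finite (A - B)" if "A \<subseteq> B" for A B :: "nat set"
    using that by (metis Diff_eq_empty_iff finite.emptyI)
  show "inf a b \<le> a" by transfer (rule sub, rule Int_lower1)
  show "inf a b \<le> b" by transfer (rule sub, rule Int_lower2)
  show "a \<le> b \<Longrightarrow> a \<le> c \<Longrightarrow> a \<le> inf b c" by transfer (simp add: Diff_Int)
  show "a \<le> sup a b" by transfer (rule sub, rule Un_upper1)
  show "b \<le> sup a b" by transfer (rule sub, rule Un_upper2)
  show "b \<le> a \<Longrightarrow> c \<le> a \<Longrightarrow> sup b c \<le> a" by transfer (simp add: Un_Diff)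
  show "bot \<le> a" by transfer simp
  show "a \<le> top" by transfer simp
  show "sup a (inf b c) = inf (sup a b) (sup a c)"
    by transfer (simp add: Un_Int_distrib eq_fin_def)
  show "inf a (- a) = bot" by transfer (simp add: eq_fin_def)
  show "sup a (- a) = top" by transfer (simp add: eq_fin_def)
  show "a - b = inf a (- b)" by transfer (simp add: Diff_eq eq_fin_def)
qed

end


section \<open>Rotary permutations\<close>

definition rot_interval :: "(nat \<Rightarrow> nat) \<Rightarrow> nat \<Rightarrow> nat set" where
  "rot_interval n k = {(\<Sum>i<k. n i) ..< (\<Sum>i\<le>k. n i)}"

text \<open>This is meaningful only when all \<open>n k\<close> are positive: then the intervals are nonempty and
  partition the natural numbers, so the index \<open>k\<close> below exists and is unique.\<close>

definition rotary :: "(nat \<Rightarrow> nat) \<Rightarrow> nat \<Rightarrow> nat" where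
  "rotary n i = (let k = (THE k. i \<in> rot_interval n k) in
     if i = Max (rot_interval n k) then Min (rot_interval n k) else i + 1)"

lemma ex1_rot_interval:
  assumes pos: "\<And>k. 0 < n k"
  shows "\<exists>!k. i \<in> rot_interval n k"
proof -
  define s where "s k = (\<Sum>i<k. n i)" for k
  have s_Suc: "s (Suc k) = s k + n k" for k by (simp add: s_def)
  have I: "rot_interval n k = {s k ..< s (Suc k)}" for k
    by (simp add: rot_interval_def s_def lessThan_Suc_atMost)
  have sm: "strict_mono s" using pos by (simp add: strict_mono_Suc_iff s_Suc)
  define k where "k = (LEAST k. i < s (Suc k))"
  have "i < s (Suc i)" using strict_mono_imp_increasing[OF sm, of "Suc i"] by simp
  then have "i < s (Suc k)" unfolding k_def by (rule LeastI)
  moreover have "s k \<le> i"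
  proof (cases k)
    case 0 then show ?thesis by (simp add: s_def)
  next
    case (Suc l)
    then have "\<not> i < s (Suc l)" using not_less_Least[of l "\<lambda>k. i < s (Suc k)"] k_def by simp
    then show ?thesis using Suc by simp
  qed
  ultimately show ?thesis
  proof (intro ex1I[of _ k])
    fix l assume "i \<in> rot_interval n l"
    with \<open>i < s (Suc k)\<close> \<open>s k \<le> i\<close> have "s l < s (Suc k)" "s k < s (Suc l)" by (auto simp: I)
    then show "l = k" using strict_mono_less[OF sm] by force
  qed (simp add: I)
qed

text \<open>The map induced by \<open>rotary n\<close> on equivalence classes.\<close>

lift_definition rot_aut :: "(nat \<Rightarrow> nat) \<Rightarrow> pnat_fin \<Rightarrow> pnat_fin" is "\<lambda>n A. rotary n ` A"
  unfolding eq_fin_def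
  subgoal for n A B
    by (rule finite_subset[of _ "rotary n ` sym_diff A B"]) auto
  done

end

theory Submission imports Defs begin

text \<open>A fixed point of the automorphism is, modulo finite, a union of intervals \<open>I\<^sub>k\<close>. Hence it is
  first-order expressible that \<open>e\<close> meets almost every \<open>I\<^sub>k\<close> below a fixed point \<open>x\<close> in exactly one
  point: fixed points disjoint from \<open>e\<close> are disjoint from \<open>x\<close>, and every part of \<open>e\<close> is cut out by
  a fixed point. Given such an \<open>e\<close>, colour \<open>x\<close> by residues modulo \<open>m\<close> so that the colour grows by
  1 along the rotation, except that it grows by \<open>1 - j\<close> on arrival in \<open>e\<close>. Summing the increments
  around \<open>I\<^sub>k\<close> shows that such a colouring of \<open>I\<^sub>k\<close> exists iff \<open>n\<^sub>k - j\<close> is divisible by \<open>m\<close>. Now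
  \<open>\<phi>\<close> asserts that a coloured \<open>x\<close> exists with \<open>x = 1\<close>, and \<open>\<psi>\<close> that one exists with \<open>x \<noteq> 0\<close>.\<close>

section \<open>Conditions on fixed points, to be expressed in first-order logic\<close>

definition transversal :: "('a::boolean_algebra \<Rightarrow> 'a) \<Rightarrow> 'a \<Rightarrow> 'a \<Rightarrow> bool" where
  "transversal f x e \<longleftrightarrow>
    (\<forall>d. \<exists>y. f y = y \<and> inf e d = inf e y) \<and>
    (\<forall>y. f y = y \<and> inf e y = bot \<longrightarrow> inf x y = bot)"

text \<open>The first clause amounts to \<open>x\<close> lying below the join of the
  \<open>a l\<close>; quantifying over \<open>y\<close> avoids an iterated join term. With natural
  numbers as residues, adding 1 - j is written \<open>Suc l + (m - j)\<close>.\<close>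

definition colouring ::
    "nat \<Rightarrow> nat \<Rightarrow> ('a::boolean_algebra \<Rightarrow> 'a) \<Rightarrow> 'a \<Rightarrow> 'a \<Rightarrow> (nat \<Rightarrow> 'a) \<Rightarrow> bool" where
  "colouring m j f x e a \<longleftrightarrow>
    (\<forall>y. (\<forall>l<m. inf y (a l) = bot) \<longrightarrow> inf x y = bot) \<and>
    (\<forall>l<m. \<forall>l'<m. l \<noteq> l' \<longrightarrow> inf (a l) (a l') = bot) \<and>
    (\<forall>l<m. inf (inf (f (a l)) (- e)) (- a (Suc l mod m)) = bot) \<and>
    (\<forall>l<m. inf (inf (f (a l)) e) (- a ((Suc l + (m - j)) mod m)) = bot)"

definition coloured ::
    "nat \<Rightarrow> nat \<Rightarrow> ('a::boolean_algebra \<Rightarrow> 'a) \<Rightarrow> 'a \<Rightarrow> bool" where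
  "coloured m j f x \<longleftrightarrow> f x = x \<and> (\<exists>e a. transversal f x e \<and> colouring m j f x e a)"

section \<open>Sets modulo finite, interval by interval\<close>

lemma abs_rep_pnat_fin: "abs_pnat_fin (rep_pnat_fin a) = a"
  by (rule Quotient3_abs_rep[OF Quotient3_pnat_fin])

text \<open>A filter is closed under finite intersections. This lets the clauses of
  \<open>colouring\<close>, one for each residue, hold on one common cofinite set of
  intervals.\<close>

lemma eventually_all_less_distrib:
  fixes m :: nat
  shows "(\<forall>\<^sub>F k in F. \<forall>l<m. P l k) \<longleftrightarrow> (\<forall>l<m. \<forall>\<^sub>F k in F. P l k)"
  using eventually_ball_finite_distrib[of "{..<m}" "\<lambda>k l. P l k" F] by (simp add: Ball_def)

lemma eventually_const_imp: "(\<forall>\<^sub>F k in F. c \<longrightarrow> P k) \<longleftrightarrow> (c \<longrightarrow> (\<forall>\<^sub>F k in F. P k))"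
  by (cases c) simp_all

section \<open>Intervals and the rotation on each of them\<close>

definition rot_start :: "(nat \<Rightarrow> nat) \<Rightarrow> nat \<Rightarrow> nat" where
  "rot_start n k = (\<Sum>i<k. n i)"

definition rot_index :: "(nat \<Rightarrow> nat) \<Rightarrow> nat \<Rightarrow> nat" where
  "rot_index n i = (THE k. i \<in> rot_interval n k)"

lemma rot_start_Suc: "rot_start n (Suc k) = rot_start n k + n k"
  by (simp add: rot_start_def)

lemma rot_interval_eq: "rot_interval n k = {rot_start n k ..< rot_start n (Suc k)}"
  by (simp add: rot_interval_def rot_start_def lessThan_Suc_atMost)

lemma finite_rot_interval [simp]: "finite (rot_interval n k)"
  by (simp add: rot_interval_def)

lemma card_rot_interval: "card (rot_interval n k) = n k"
  by (simp add: rot_interval_eq rot_start_Suc)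

context
  fixes n :: "nat \<Rightarrow> nat"
  assumes pos: "\<And>k. 0 < n k"
begin

lemma rot_index_iff: "i \<in> rot_interval n k \<longleftrightarrow> rot_index n i = k"
  unfolding rot_index_def
  using theI'[OF ex1_rot_interval[of n i]] the1_equality[OF ex1_rot_interval[of n i]] pos
  by blast

lemma rot_start_in: "rot_start n k \<in> rot_interval n k"
  by (simp add: rot_interval_eq rot_start_Suc pos)

lemma rotary_eq:
  assumes "i \<in> rot_interval n k"
  shows "rotary n i = (if Suc i = rot_start n (Suc k) then rot_start n k else Suc i)"
proof -
  have ne: "rot_start n k < rot_start n (Suc k)"
    by (simp add: rot_start_Suc pos)
  have "Max (rot_interval n k) = rot_start n (Suc k) - 1"
    using ne by (intro Max_eqI) (auto simp: rot_interval_eq)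
  moreover have "Min (rot_interval n k) = rot_start n k"
    using ne by (intro Min_eqI) (auto simp: rot_interval_eq)
  moreover have "(THE l. i \<in> rot_interval n l) = k"
    using assms unfolding rot_index_iff by (simp add: rot_index_def)
  ultimately show ?thesis
    using ne by (auto simp: rotary_def)
qed

lemma rotary_in:
  assumes "i \<in> rot_interval n k" shows "rotary n i \<in> rot_interval n k"
  using assms rot_start_in[of k] unfolding rotary_eq[OF assms] by (auto simp: rot_interval_eq)

lemma rot_index_rotary: "rot_index n (rotary n i) = rot_index n i"
  using rotary_in[of i "rot_index n i"] by (simp add: rot_index_iff)

lemma bij_betw_rotary: "bij_betw (rotary n) (rot_interval n k) (rot_interval n k)"
proof -
  have "inj_on (rotary n) (rot_interval n k)"
    by (rule inj_onI) (auto simp: rotary_eq rot_interval_eq split: if_splits)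
  moreover have "rotary n ` rot_interval n k \<subseteq> rot_interval n k"
    using rotary_in by blast
  ultimately show ?thesis
    by (simp add: bij_betw_def endo_inj_surj)
qed

lemma image_rotary_Int: "rotary n ` A \<inter> rot_interval n k = rotary n ` (A \<inter> rot_interval n k)"
  by (auto simp: rot_index_iff rot_index_rotary)

text \<open>The rotation acts on an interval as one cycle, so a point of \<open>A\<close> can be
  carried up to the right end, over to the left end, and from there to every point.\<close>

lemma rotary_invariant:
  assumes inv: "rotary n ` (A \<inter> rot_interval n k) = A \<inter> rot_interval n k"
  shows "rot_interval n k \<subseteq> A \<or> A \<inter> rot_interval n k = {}"
proof (rule disjCI)
  let ?I = "rot_interval n k"
  assume "A \<inter> ?I \<noteq> {}"
  then obtain i where i: "i \<in> A" "i \<in> ?I" by blast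
  have closed: "rotary n l \<in> A" if "l \<in> A" "l \<in> ?I" for l
    using inv that by blast
  have up: "l \<in> A" if "i0 \<le> l" "i0 \<in> A" "i0 \<in> ?I" "l \<in> ?I" for l i0
    using that
  proof (induction l rule: dec_induct)
    case (step l)
    then have "l \<in> ?I" by (auto simp: rot_interval_eq)
    with step have "l \<in> A" by blast
    then have "rotary n l \<in> A" using \<open>l \<in> ?I\<close> closed by blast
    then show ?case
      using step.prems \<open>l \<in> ?I\<close> rotary_eq[of l k] by (auto simp: rot_interval_eq)
  qed simp
  let ?l = "rot_start n (Suc k) - 1"
  have l: "?l \<in> ?I" "i \<le> ?l" "Suc ?l = rot_start n (Suc k)"
    using i(2) by (auto simp: rot_interval_eq)
  then have "rot_start n k \<in> A"
    using closed[of ?l] up[of i ?l] i rotary_eq[of ?l k] by simp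
  then show "?I \<subseteq> A"
    using up[of "rot_start n k"] rot_start_in by (auto simp: rot_interval_eq)
qed

text \<open>The intervals are finite and partition the natural numbers. Through this equivalence
  every identity modulo finite sets becomes a claim about almost every interval.\<close>

lemma finite_iff_rot_interval: "finite A \<longleftrightarrow> (\<forall>\<^sub>\<infinity>k. A \<inter> rot_interval n k = {})"
proof
  assume "finite A"
  then have "finite (rot_index n ` A)" by simp
  moreover have "{k. A \<inter> rot_interval n k \<noteq> {}} \<subseteq> rot_index n ` A"
    by (auto simp: rot_index_iff)
  ultimately show "\<forall>\<^sub>\<infinity>k. A \<inter> rot_interval n k = {}"
    unfolding eventually_cofinite by (rule finite_subset[rotated])
next
  assume "\<forall>\<^sub>\<infinity>k. A \<inter> rot_interval n k = {}"
  then have "finite (\<Union>k\<in>{k. A \<inter> rot_interval n k \<noteq> {}}. rot_interval n k)"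
    by (simp add: eventually_cofinite)
  moreover have "A \<subseteq> (\<Union>k\<in>{k. A \<inter> rot_interval n k \<noteq> {}}. rot_interval n k)"
  proof
    fix i assume "i \<in> A"
    moreover have "i \<in> rot_interval n (rot_index n i)" by (simp add: rot_index_iff)
    ultimately show "i \<in> (\<Union>k\<in>{k. A \<inter> rot_interval n k \<noteq> {}}. rot_interval n k)" by blast
  qed
  ultimately show "finite A" by (rule finite_subset[rotated])
qed

lemma abs_pnat_fin_eq_iff:
  "abs_pnat_fin A = abs_pnat_fin B \<longleftrightarrow>
    (\<forall>\<^sub>\<infinity>k. A \<inter> rot_interval n k = B \<inter> rot_interval n k)"
proof -
  have "sym_diff A B \<inter> rot_interval n k = {} \<longleftrightarrow> A \<inter> rot_interval n k = B \<inter> rot_interval n k" for k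
    by blast
  then show ?thesis
    by (simp add: pnat_fin.abs_eq_iff eq_fin_def finite_iff_rot_interval[of "sym_diff A B"]
        del: finite_Un)
qed

lemma abs_pnat_fin_eq_bot_iff:
  "abs_pnat_fin A = bot \<longleftrightarrow> (\<forall>\<^sub>\<infinity>k. A \<inter> rot_interval n k = {})"
  by (simp add: bot_pnat_fin_def abs_pnat_fin_eq_iff)

lemma abs_pnat_fin_eq_top_iff:
  "abs_pnat_fin A = top \<longleftrightarrow> (\<forall>\<^sub>\<infinity>k. rot_interval n k \<subseteq> A)"
  by (simp add: top_pnat_fin_def abs_pnat_fin_eq_iff Int_absorb1 inf.absorb_iff2)

text \<open>Since the rotation preserves each interval, invariance is tested interval by interval,
  and \<open>rotary_invariant\<close> leaves only the two trivial cases.\<close>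

lemma rot_aut_fixed_iff:
  "rot_aut n (abs_pnat_fin A) = abs_pnat_fin A \<longleftrightarrow>
    (\<forall>\<^sub>\<infinity>k. rot_interval n k \<subseteq> A \<or> A \<inter> rot_interval n k = {})"
proof -
  have "rotary n ` (A \<inter> rot_interval n k) = A \<inter> rot_interval n k \<longleftrightarrow>
      rot_interval n k \<subseteq> A \<or> A \<inter> rot_interval n k = {}" for k
    using rotary_invariant[of A k] bij_betw_rotary[of k]
    by (auto simp: bij_betw_def Int_absorb1)
  then show ?thesis
    by (simp add: rot_aut.abs_eq abs_pnat_fin_eq_iff image_rotary_Int)
qed

section \<open>Coloured fixed points\<close>

lemma transversal_imp_card_1:
  assumes fixed: "rot_aut n (abs_pnat_fin X) = abs_pnat_fin X"
    and trans: "transversal (rot_aut n) (abs_pnat_fin X) (abs_pnat_fin E)"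
  shows "\<forall>\<^sub>\<infinity>k. X \<inter> rot_interval n k \<noteq> {} \<longrightarrow> card (E \<inter> rot_interval n k) = 1"
proof -
  let ?I = "rot_interval n"
  \<comment> \<open>\<open>D\<close> collects the least point of \<open>E\<close> in each interval;
    it is the part of \<open>E\<close> to which the cutting-out condition is applied.\<close>
  define D where "D = {i \<in> E. \<forall>i'\<in>E. rot_index n i' = rot_index n i \<longrightarrow> i \<le> i'}"
  have "\<exists>y. rot_aut n y = y \<and> inf (abs_pnat_fin E) (abs_pnat_fin D) = inf (abs_pnat_fin E) y"
    using trans by (simp add: transversal_def)
  then obtain y where y: "rot_aut n y = y"
      "inf (abs_pnat_fin E) (abs_pnat_fin D) = inf (abs_pnat_fin E) y"
    by blast
  obtain Y where Y: "y = abs_pnat_fin Y" by (metis abs_rep_pnat_fin)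
  have Y1: "\<forall>\<^sub>\<infinity>k. ?I k \<subseteq> Y \<or> Y \<inter> ?I k = {}"
    using y(1) unfolding Y by (simp add: rot_aut_fixed_iff pos)
  have Y2: "\<forall>\<^sub>\<infinity>k. E \<inter> D \<inter> ?I k = E \<inter> Y \<inter> ?I k"
    using y(2) unfolding Y by (simp add: inf_pnat_fin.abs_eq abs_pnat_fin_eq_iff)
  \<comment> \<open>\<open>Z\<close> is the union of the intervals missed by \<open>E\<close>. It is
    fixed and disjoint from \<open>E\<close>, hence almost disjoint from \<open>X\<close>; so
    \<open>E\<close> has a point in almost every interval that \<open>X\<close> meets.\<close>
  define Z where "Z = {i. E \<inter> ?I (rot_index n i) = {}}"
  have Z: "Z \<inter> ?I k = (if E \<inter> ?I k = {} then ?I k else {})" for k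
    using rot_index_iff by (auto simp: Z_def)
  have "rot_aut n (abs_pnat_fin Z) = abs_pnat_fin Z"
  proof -
    have "?I k \<subseteq> Z \<or> Z \<inter> ?I k = {}" for k using Z[of k] by (auto split: if_splits)
    then show ?thesis by (simp add: rot_aut_fixed_iff pos)
  qed
  moreover have "inf (abs_pnat_fin E) (abs_pnat_fin Z) = bot"
  proof -
    have "E \<inter> Z \<inter> ?I k = {}" for k using Z[of k] by (auto split: if_splits)
    then show ?thesis by (simp add: inf_pnat_fin.abs_eq abs_pnat_fin_eq_bot_iff)
  qed
  ultimately have "inf (abs_pnat_fin X) (abs_pnat_fin Z) = bot"
    using trans by (simp add: transversal_def)
  then have XZ: "\<forall>\<^sub>\<infinity>k. X \<inter> Z \<inter> ?I k = {}"
    by (simp add: inf_pnat_fin.abs_eq abs_pnat_fin_eq_bot_iff)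
  show ?thesis
    using Y1 Y2 XZ
  proof eventually_elim
    case (elim k)
    show ?case
    proof
      assume "X \<inter> ?I k \<noteq> {}"
      then have ne: "E \<inter> ?I k \<noteq> {}" using elim(3) Z[of k] by (auto split: if_splits)
      define i where "i = Min (E \<inter> ?I k)"
      have i: "i \<in> E \<inter> ?I k" "\<And>i'. i' \<in> E \<inter> ?I k \<Longrightarrow> i \<le> i'"
        using ne Min_in[of "E \<inter> ?I k"] by (auto simp: i_def)
      then have "i \<in> D" by (auto simp: D_def rot_index_iff)
      \<comment> \<open>\<open>Y\<close> contains one point of the interval, hence all of it, so
        every point of \<open>E\<close> there belongs to \<open>D\<close> and is least.\<close>
      with i elim have "?I k \<subseteq> Y" by blast
      with elim have sub: "E \<inter> ?I k \<subseteq> D" by blast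
      have "i' = i" if "i' \<in> E \<inter> ?I k" for i'
      proof (rule antisym)
        have "rot_index n i' = k" "rot_index n i = k" "i' \<in> D"
          using that i(1) sub rot_index_iff by blast+
        then show "i' \<le> i" using i(1) by (auto simp: D_def)
      qed (use i(2) that in blast)
      with i(1) have "E \<inter> ?I k = {i}" by blast
      then show "card (E \<inter> ?I k) = 1" by simp
    qed
  qed
qed

text \<open>Sum the congruences over the interval. The rotation permutes it, so the values of
  \<open>c\<close> cancel; the one point of \<open>E\<close> leaves \<open>j\<close> on the left,
  and the increments leave \<open>n k\<close> on the right.\<close>

lemma cong_if_colouring_step:
  fixes c :: "nat \<Rightarrow> nat"
  assumes card: "card (E \<inter> rot_interval n k) = 1"
    and step: "\<And>i. i \<in> rot_interval n k \<Longrightarrow>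
      [c (rotary n i) + (if rotary n i \<in> E then j else 0) = c i + 1] (mod m)"
  shows "[n k = j] (mod m)"
proof -
  let ?I = "rot_interval n k"
  let ?g = "\<lambda>i. c i + (if i \<in> E then j else 0)"
  have "(\<Sum>i\<in>?I. ?g (rotary n i)) = (\<Sum>i\<in>?I. ?g i)"
    using sum.reindex_bij_betw[OF bij_betw_rotary, of ?g k] by simp
  also have "\<dots> = (\<Sum>i\<in>?I. c i) + (\<Sum>i\<in>E \<inter> ?I. j)"
    by (simp add: sum.distrib sum.If_cases Int_commute Collect_conj_eq)
  finally have "(\<Sum>i\<in>?I. ?g (rotary n i)) = (\<Sum>i\<in>?I. c i) + j"
    using card by simp
  moreover have "[(\<Sum>i\<in>?I. ?g (rotary n i)) = (\<Sum>i\<in>?I. c i + 1)] (mod m)"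
    using step by (rule cong_sum)
  ultimately have "[(\<Sum>i\<in>?I. c i) + j = (\<Sum>i\<in>?I. c i) + n k] (mod m)"
    by (simp add: sum.distrib card_rot_interval del: One_nat_def)
  then show ?thesis by (simp add: cong_add_lcancel_nat cong_sym)
qed

text \<open>On almost every interval the required identities hold literally for representatives. On
  such an interval inside \<open>X\<close> the classes \<open>A l\<close> define an actual colour
  function, to which \<open>cong_if_colouring_step\<close> applies.\<close>

lemma coloured_imp_cong:
  assumes "j < m" and col: "coloured m j (rot_aut n) (abs_pnat_fin X)"
  shows "\<forall>\<^sub>\<infinity>k. X \<inter> rot_interval n k \<noteq> {} \<longrightarrow> [n k = j] (mod m)"
proof -
  let ?I = "rot_interval n"
  obtain e a where fixed: "rot_aut n (abs_pnat_fin X) = abs_pnat_fin X"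
    and trans: "transversal (rot_aut n) (abs_pnat_fin X) e"
    and colr: "colouring m j (rot_aut n) (abs_pnat_fin X) e a"
    using col by (auto simp: coloured_def)
  obtain E where E: "e = abs_pnat_fin E" by (metis abs_rep_pnat_fin)
  define A where "A l = rep_pnat_fin (a l)" for l
  have A: "a l = abs_pnat_fin (A l)" for l
    by (simp add: A_def abs_rep_pnat_fin)
  have "\<forall>\<^sub>\<infinity>k. ?I k \<subseteq> X \<or> X \<inter> ?I k = {}"
    using fixed by (simp add: rot_aut_fixed_iff pos)
  moreover have "\<forall>\<^sub>\<infinity>k. X \<inter> ?I k \<noteq> {} \<longrightarrow> card (E \<inter> ?I k) = 1"
    using transversal_imp_card_1 fixed trans E by simp
  moreover have "\<forall>\<^sub>\<infinity>k. X \<inter> ?I k \<subseteq> (\<Union>l<m. A l)"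
  proof -
    \<comment> \<open>The complement of all colour classes is the test element for the covering
      clause.\<close>
    let ?Y = "- (\<Union>l<m. A l)"
    have "inf (abs_pnat_fin ?Y) (a l) = bot" if "l < m" for l
    proof -
      have "?Y \<inter> A l = {}" using that by blast
      then show ?thesis by (simp add: A inf_pnat_fin.abs_eq bot_pnat_fin_def)
    qed
    then have "inf (abs_pnat_fin X) (abs_pnat_fin ?Y) = bot"
      using colr by (simp add: colouring_def)
    then have "\<forall>\<^sub>\<infinity>k. X \<inter> ?Y \<inter> ?I k = {}"
      by (simp add: inf_pnat_fin.abs_eq abs_pnat_fin_eq_bot_iff)
    then show ?thesis by eventually_elim blast
  qed
  moreover have "\<forall>\<^sub>\<infinity>k. \<forall>l<m. \<forall>l'<m. l \<noteq> l' \<longrightarrow> A l \<inter> A l' \<inter> ?I k = {}"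
    using colr
    by (simp add: colouring_def A inf_pnat_fin.abs_eq abs_pnat_fin_eq_bot_iff
        eventually_all_less_distrib eventually_const_imp)
  moreover have "\<forall>\<^sub>\<infinity>k. \<forall>l<m. rotary n ` A l \<inter> - E \<inter> - A (Suc l mod m) \<inter> ?I k = {}"
    using colr
    by (simp add: colouring_def A E inf_pnat_fin.abs_eq uminus_pnat_fin.abs_eq rot_aut.abs_eq
        abs_pnat_fin_eq_bot_iff eventually_all_less_distrib)
  moreover have "\<forall>\<^sub>\<infinity>k. \<forall>l<m. rotary n ` A l \<inter> E \<inter> - A ((Suc l + (m - j)) mod m) \<inter> ?I k = {}"
    using colr
    by (simp add: colouring_def A E inf_pnat_fin.abs_eq uminus_pnat_fin.abs_eq rot_aut.abs_eq
        abs_pnat_fin_eq_bot_iff eventually_all_less_distrib)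
  ultimately show ?thesis
  proof eventually_elim
    case (elim k)
    show ?case
    proof
      assume ne: "X \<inter> ?I k \<noteq> {}"
      then have sub: "?I k \<subseteq> X" using elim(1) by blast
      \<comment> \<open>A colour exists since the classes cover \<open>X\<close> on this interval;
        it is unique since they are disjoint there (\<open>c_eq\<close>).\<close>
      define c where "c i = (SOME l. l < m \<and> i \<in> A l)" for i
      have c: "c i < m \<and> i \<in> A (c i)" if "i \<in> ?I k" for i
      proof -
        have "\<exists>l. l < m \<and> i \<in> A l" using that sub elim(3) by blast
        then show ?thesis unfolding c_def by (rule someI_ex)
      qed
      have c_eq: "c i = l" if "i \<in> ?I k" "l < m" "i \<in> A l" for i l
        using c[OF that(1)] elim(4) that by blast
      show "[n k = j] (mod m)"
      proof (rule cong_if_colouring_step[where c = c and E = E])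
        show "card (E \<inter> ?I k) = 1" using elim(2) ne by blast
        fix i assume i: "i \<in> ?I k"
        then have r: "rotary n i \<in> ?I k" by (rule rotary_in)
        note ci = c[OF i]
        show "[c (rotary n i) + (if rotary n i \<in> E then j else 0) = c i + 1] (mod m)"
        proof (cases "rotary n i \<in> E")
          case True
          then have "rotary n i \<in> A ((Suc (c i) + (m - j)) mod m)"
            using ci r elim(6) by blast
          then have "c (rotary n i) = (Suc (c i) + (m - j)) mod m"
            using r c_eq \<open>j < m\<close> by simp
          \<comment> \<open>Adding \<open>j\<close> back completes \<open>m - j\<close> to
            \<open>m\<close>, which vanishes modulo \<open>m\<close>.\<close>
          then have "(c (rotary n i) + j) mod m = (Suc (c i) + (m - j) + j) mod m"
            by (metis mod_add_left_eq)
          also have "\<dots> = Suc (c i) mod m" using \<open>j < m\<close> by (simp flip: add_Suc)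
          finally show ?thesis using True by (simp add: cong_def)
        next
          case False
          then have "rotary n i \<in> A (Suc (c i) mod m)"
            using ci r elim(5) by blast
          then have "c (rotary n i) = Suc (c i) mod m"
            using r c_eq \<open>j < m\<close> by simp
          then show ?thesis using False by (simp add: cong_def)
        qed
      qed
    qed
  qed
qed

text \<open>The transversal consists of the left endpoints, and a point is coloured by its distance
  from the left endpoint modulo \<open>m\<close>. The distance grows by 1 except at the wrap, where
  it falls from \<open>n k - 1\<close> to 0; for \<open>k\<close> in \<open>K\<close> this change is
  1 - j modulo \<open>m\<close>.\<close>

lemma cong_imp_coloured:
  assumes "j < m" and cong: "\<And>k. k \<in> K \<Longrightarrow> [n k = j] (mod m)"
  shows "coloured m j (rot_aut n) (abs_pnat_fin (\<Union>k\<in>K. rot_interval n k))"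
proof -
  let ?I = "rot_interval n" and ?s = "rot_start n" and ?k = "rot_index n"
  define X where "X = (\<Union>k\<in>K. ?I k)"
  define E where "E = range ?s"
  define A where "A l = {i \<in> X. (i - ?s (?k i)) mod m = l}" for l
  have idx: "i \<in> ?I k \<longleftrightarrow> ?k i = k" for i k by (rule rot_index_iff)
  have in_X: "i \<in> X \<longleftrightarrow> ?k i \<in> K" for i by (auto simp: X_def idx)
  have s_idx: "?k (?s k) = k" for k
    using rot_start_in idx by blast
  have E_idx: "i = ?s (?k i)" if "i \<in> E" for i
    using that by (auto simp: E_def s_idx)
  have fixed: "rot_aut n (abs_pnat_fin X) = abs_pnat_fin X"
  proof -
    have "?I k \<subseteq> X \<or> X \<inter> ?I k = {}" for k using in_X idx by fastforce
    then show ?thesis by (simp add: rot_aut_fixed_iff pos)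
  qed
  have "transversal (rot_aut n) (abs_pnat_fin X) (abs_pnat_fin E)"
    unfolding transversal_def
  proof (intro conjI allI impI)
    fix d
    obtain D where D: "d = abs_pnat_fin D" by (metis abs_rep_pnat_fin)
    \<comment> \<open>Spreading each endpoint in \<open>D\<close> over its whole interval gives a
      fixed point with the same trace on \<open>E\<close>.\<close>
    define Y where "Y = {i. ?s (?k i) \<in> D}"
    have "?I k \<subseteq> Y \<or> Y \<inter> ?I k = {}" for k using idx by (auto simp: Y_def)
    then have "rot_aut n (abs_pnat_fin Y) = abs_pnat_fin Y"
      by (simp add: rot_aut_fixed_iff pos)
    moreover have "E \<inter> D = E \<inter> Y"
      by (auto simp: E_def Y_def s_idx)
    ultimately show "\<exists>y. rot_aut n y = y \<and> inf (abs_pnat_fin E) d = inf (abs_pnat_fin E) y"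
      unfolding D by (metis inf_pnat_fin.abs_eq)
  next
    fix y assume y: "rot_aut n y = y \<and> inf (abs_pnat_fin E) y = bot"
    obtain Y where Y: "y = abs_pnat_fin Y" by (metis abs_rep_pnat_fin)
    have "\<forall>\<^sub>\<infinity>k. ?I k \<subseteq> Y \<or> Y \<inter> ?I k = {}"
      using y unfolding Y by (simp add: rot_aut_fixed_iff pos)
    moreover have "\<forall>\<^sub>\<infinity>k. E \<inter> Y \<inter> ?I k = {}"
      using y unfolding Y by (simp add: inf_pnat_fin.abs_eq abs_pnat_fin_eq_bot_iff)
    ultimately have "\<forall>\<^sub>\<infinity>k. X \<inter> Y \<inter> ?I k = {}"
    proof eventually_elim
      case (elim k)
      \<comment> \<open>If the interval were inside \<open>Y\<close>, its left endpoint would lie in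
        both \<open>E\<close> and \<open>Y\<close>.\<close>
      have "?s k \<in> E \<inter> ?I k" using rot_start_in by (simp add: E_def)
      with elim show ?case by blast
    qed
    then show "inf (abs_pnat_fin X) y = bot"
      by (simp add: Y inf_pnat_fin.abs_eq abs_pnat_fin_eq_bot_iff)
  qed
  moreover have "colouring m j (rot_aut n) (abs_pnat_fin X) (abs_pnat_fin E)
      (\<lambda>l. abs_pnat_fin (A l))"
    unfolding colouring_def
  proof (intro conjI allI impI)
    fix y assume y: "\<forall>l<m. inf y (abs_pnat_fin (A l)) = bot"
    obtain Y where Y: "y = abs_pnat_fin Y" by (metis abs_rep_pnat_fin)
    have "finite (Y \<inter> A l)" if "l < m" for l
      using y that by (simp add: Y inf_pnat_fin.abs_eq abs_pnat_fin_eq_bot_iff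
          finite_iff_rot_interval[of "Y \<inter> A l"] del: finite_Int)
    then have "finite (\<Union>l<m. Y \<inter> A l)" by blast
    moreover have "X \<inter> Y \<subseteq> (\<Union>l<m. Y \<inter> A l)"
      using \<open>j < m\<close> by (auto simp: A_def)
    ultimately have "finite (X \<inter> Y)" by (rule finite_subset[rotated])
    then show "inf (abs_pnat_fin X) y = bot"
      by (simp add: Y inf_pnat_fin.abs_eq abs_pnat_fin_eq_bot_iff
          finite_iff_rot_interval)
  next
    fix l l' :: nat assume "l \<noteq> l'"
    then have "A l \<inter> A l' = {}" by (auto simp: A_def)
    then show "inf (abs_pnat_fin (A l)) (abs_pnat_fin (A l')) = bot"
      by (simp add: inf_pnat_fin.abs_eq bot_pnat_fin_def)
  next
    fix l
    have "rotary n i \<in> A (Suc l mod m)" if "i \<in> A l" "rotary n i \<notin> E" for i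
    proof -
      have i: "i \<in> ?I (?k i)" by (simp add: idx)
      \<comment> \<open>Missing \<open>E\<close> means missing the left endpoint, so no wrap
        occurs.\<close>
      have "rotary n i = Suc i"
        using rotary_eq[OF i] that(2) by (auto simp: E_def split: if_splits)
      moreover have "?s (?k i) \<le> i" using i by (simp add: rot_interval_eq)
      ultimately show ?thesis
        using that(1) rot_index_rotary[of i]
        by (auto simp: A_def in_X Suc_diff_le mod_Suc_eq)
    qed
    then have "rotary n ` A l \<inter> - E \<inter> - A (Suc l mod m) = {}" by blast
    then show "inf (inf (rot_aut n (abs_pnat_fin (A l))) (- abs_pnat_fin E))
        (- abs_pnat_fin (A (Suc l mod m))) = bot"
      by (simp add: inf_pnat_fin.abs_eq uminus_pnat_fin.abs_eq rot_aut.abs_eq bot_pnat_fin_def)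
  next
    fix l
    have "rotary n i \<in> A ((Suc l + (m - j)) mod m)" if "i \<in> A l" "rotary n i \<in> E" for i
    proof -
      define k where "k = ?k i"
      have i: "i \<in> ?I k" by (simp add: idx k_def)
      have r: "rotary n i = ?s k"
        using E_idx[OF that(2)] rot_index_rotary[of i] by (simp add: k_def)
      \<comment> \<open>Only the last point of the interval arrives at the left endpoint; its
        distance is \<open>n k - 1\<close>.\<close>
      have "Suc i = ?s (Suc k)"
        using rotary_eq[OF i] r i by (auto simp: rot_interval_eq split: if_splits)
      then have "Suc (i - ?s k) = n k"
        using i by (simp add: rot_interval_eq rot_start_Suc)
      moreover have "k \<in> K" and l: "l = (i - ?s k) mod m"
        using that(1) by (auto simp: A_def in_X k_def)
      ultimately have "Suc l mod m = j"
        using cong[of k] \<open>j < m\<close> by (simp add: cong_def mod_Suc_eq)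
      then have "(Suc l + (m - j)) mod m = (j + (m - j)) mod m"
        by (metis mod_add_left_eq)
      then have "(Suc l + (m - j)) mod m = 0" using \<open>j < m\<close> by simp
      then show ?thesis
        using r \<open>k \<in> K\<close> by (simp add: A_def in_X s_idx)
    qed
    then have "rotary n ` A l \<inter> E \<inter> - A ((Suc l + (m - j)) mod m) = {}" by blast
    then show "inf (inf (rot_aut n (abs_pnat_fin (A l))) (abs_pnat_fin E))
        (- abs_pnat_fin (A ((Suc l + (m - j)) mod m))) = bot"
      by (simp add: inf_pnat_fin.abs_eq uminus_pnat_fin.abs_eq rot_aut.abs_eq bot_pnat_fin_def)
  qed
  ultimately show ?thesis
    using fixed unfolding coloured_def X_def by blast
qed

section \<open>Coloured top element and coloured nonzero elements\<close>

lemma coloured_top_iff: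
  assumes "j < m"
  shows "coloured m j (rot_aut n) top \<longleftrightarrow> (\<forall>\<^sub>\<infinity>k. [n k = j] (mod m))"
proof
  assume "coloured m j (rot_aut n) top"
  then have "\<forall>\<^sub>\<infinity>k. UNIV \<inter> rot_interval n k \<noteq> {} \<longrightarrow> [n k = j] (mod m)"
    unfolding top_pnat_fin_def by (rule coloured_imp_cong[OF assms])
  moreover have "rot_interval n k \<noteq> {}" for k
    using rot_start_in by blast
  ultimately show "\<forall>\<^sub>\<infinity>k. [n k = j] (mod m)" by simp
next
  assume *: "\<forall>\<^sub>\<infinity>k. [n k = j] (mod m)"
  let ?X = "\<Union>k\<in>{k. [n k = j] (mod m)}. rot_interval n k"
  have "\<forall>\<^sub>\<infinity>k. rot_interval n k \<subseteq> ?X"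
    using * by eventually_elim blast
  then have "abs_pnat_fin ?X = top"
    by (simp add: abs_pnat_fin_eq_top_iff)
  then show "coloured m j (rot_aut n) top"
    using cong_imp_coloured[OF assms, of "{k. [n k = j] (mod m)}"] by simp
qed

text \<open>A nonzero element meets infinitely many intervals, so a condition valid on almost all
  intervals that it meets holds infinitely often. Conversely, a union of infinitely many intervals
  is nonzero.\<close>

lemma coloured_nonzero_iff:
  assumes "j < m"
  shows "(\<exists>x. x \<noteq> bot \<and> coloured m j (rot_aut n) x) \<longleftrightarrow> (\<exists>\<^sub>\<infinity>k. [n k = j] (mod m))"
proof
  assume "\<exists>x. x \<noteq> bot \<and> coloured m j (rot_aut n) x"
  then obtain x where x: "x \<noteq> bot" "coloured m j (rot_aut n) x" by blast
  obtain X where X: "x = abs_pnat_fin X" by (metis abs_rep_pnat_fin)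
  have "\<exists>\<^sub>\<infinity>k. X \<inter> rot_interval n k \<noteq> {}"
    using x(1) by (simp add: X abs_pnat_fin_eq_bot_iff not_MOST)
  moreover have "\<forall>\<^sub>\<infinity>k. X \<inter> rot_interval n k \<noteq> {} \<longrightarrow> [n k = j] (mod m)"
    using x(2) unfolding X by (rule coloured_imp_cong[OF assms])
  ultimately show "\<exists>\<^sub>\<infinity>k. [n k = j] (mod m)"
    by (rule frequently_rev_mp)
next
  assume *: "\<exists>\<^sub>\<infinity>k. [n k = j] (mod m)"
  let ?X = "\<Union>k\<in>{k. [n k = j] (mod m)}. rot_interval n k"
  have "?X \<inter> rot_interval n k \<noteq> {}" if "[n k = j] (mod m)" for k
    using that rot_start_in[of k] by blast
  with * have "\<exists>\<^sub>\<infinity>k. ?X \<inter> rot_interval n k \<noteq> {}"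
    by (rule frequently_elim1)
  then have "abs_pnat_fin ?X \<noteq> bot"
    by (simp add: abs_pnat_fin_eq_bot_iff not_MOST)
  then show "\<exists>x. x \<noteq> bot \<and> coloured m j (rot_aut n) x"
    using cong_imp_coloured[OF assms, of "{k. [n k = j] (mod m)}"] by auto
qed

end

section \<open>The sentences\<close>

text \<open>\<open>Eq Zero Zero\<close> serves as the constant true, the value of the empty
  conjunction.\<close>

definition conjs :: "nat \<Rightarrow> (nat \<Rightarrow> ds_fm) \<Rightarrow> ds_fm" where
  "conjs m p = foldr (\<lambda>l. Conj (p l)) [0..<m] (Eq Zero Zero)"

lemma sat_conjs [simp]: "sat f v (conjs m p) \<longleftrightarrow> (\<forall>l<m. sat f v (p l))"
proof -
  have "sat f v (foldr (\<lambda>l. Conj (p l)) ls (Eq Zero Zero)) \<longleftrightarrow> (\<forall>l\<in>set ls. sat f v (p l))" for ls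
    by (induction ls) auto
  then show ?thesis by (auto simp: conjs_def)
qed

lemma fv_conjs [simp]: "fv (conjs m p) = (\<Union>l<m. fv (p l))"
proof -
  have "fv (foldr (\<lambda>l. Conj (p l)) ls (Eq Zero Zero)) = (\<Union>l\<in>set ls. fv (p l))" for ls
    by (induction ls) auto
  then show ?thesis by (auto simp: conjs_def)
qed

fun exs :: "nat \<Rightarrow> nat \<Rightarrow> ds_fm \<Rightarrow> ds_fm" where
  "exs x 0 p = p"
| "exs x (Suc l) p = Ex (x + l) (exs x l p)"

lemma fv_exs [simp]: "fv (exs x l p) = fv p - {x..<x + l}"
proof (induction l)
  case (Suc l)
  have "fv (exs x (Suc l) p) = fv p - {x..<x + l} - {x + l}"
    by (simp only: exs.simps fv.simps Suc.IH)
  also have "\<dots> = fv p - {x..<x + Suc l}" by auto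
  finally show ?case .
qed simp

text \<open>The values of the \<open>l\<close> bound variables are packed into one function
  \<open>a\<close>, read at the offset \<open>y - x\<close>; this matches the family of colour
  classes in \<open>colouring\<close>.\<close>

lemma sat_exs:
  "sat f v (exs x l p) \<longleftrightarrow>
    (\<exists>a. sat f (\<lambda>y. if x \<le> y \<and> y < x + l then a (y - x) else v y) p)"
proof (induction l arbitrary: v)
  case (Suc l)
  have "(\<lambda>y. if x \<le> y \<and> y < x + l then a (y - x) else (v(x + l := b)) y) =
      (\<lambda>y. if x \<le> y \<and> y < x + Suc l then (a(l := b)) (y - x) else v y)" for a b
    by (auto simp: fun_eq_iff)
  then have "sat f v (exs x (Suc l) p) \<longleftrightarrow>
      (\<exists>b a. sat f (\<lambda>y. if x \<le> y \<and> y < x + Suc l then (a(l := b)) (y - x) else v y) p)"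
    by (simp add: Suc.IH)
  \<comment> \<open>The value of the outermost quantifier becomes the entry at \<open>l\<close>;
    every function arises as some \<open>a(l := b)\<close>.\<close>
  moreover have "(\<exists>b a. Q (a(l := b))) \<longleftrightarrow> (\<exists>a. Q a)" for Q :: "(nat \<Rightarrow> 'a) \<Rightarrow> bool"
    by (metis fun_upd_triv)
  ultimately show ?case by simp
next
  case 0
  have "(\<lambda>y. if x \<le> y \<and> y < x + 0 then a (y - x) else v y) = v" for a
    by (auto simp: fun_eq_iff)
  then show ?case by simp
qed

text \<open>Variable 0 stands for \<open>x\<close>, 1 for \<open>e\<close>, and \<open>4 + l\<close> for the colour class \<open>a l\<close>; 2 and 3 are
  bound inside.\<close>

definition transversal_fm :: ds_fm where
  "transversal_fm = Conj
    (All 3 (Ex 2 (Conj (Eq (Fn (Var 2)) (Var 2))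
      (Eq (Meet (Var 1) (Var 3)) (Meet (Var 1) (Var 2))))))
    (All 2 (Imp (Conj (Eq (Fn (Var 2)) (Var 2)) (Eq (Meet (Var 1) (Var 2)) Zero))
      (Eq (Meet (Var 0) (Var 2)) Zero)))"

text \<open>Residues are indices outside the language: the comparison of \<open>l\<close> with
  \<open>l'\<close> is decided while the formula is built, with a true equation for equal
  indices.\<close>

definition colouring_fm :: "nat \<Rightarrow> nat \<Rightarrow> ds_fm" where
  "colouring_fm m j =
    Conj (All 2 (Imp (conjs m (\<lambda>l. Eq (Meet (Var 2) (Var (4 + l))) Zero))
        (Eq (Meet (Var 0) (Var 2)) Zero)))
   (Conj (conjs m (\<lambda>l. conjs m (\<lambda>l'. if l = l' then Eq Zero Zero
        else Eq (Meet (Var (4 + l)) (Var (4 + l'))) Zero)))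
   (Conj (conjs m (\<lambda>l. Eq (Meet (Meet (Fn (Var (4 + l))) (Compl (Var 1)))
        (Compl (Var (4 + Suc l mod m)))) Zero))
   (conjs m (\<lambda>l. Eq (Meet (Meet (Fn (Var (4 + l))) (Var 1))
        (Compl (Var (4 + (Suc l + (m - j)) mod m)))) Zero))))"

definition coloured_fm :: "nat \<Rightarrow> nat \<Rightarrow> ds_fm" where
  "coloured_fm m j = Conj (Eq (Fn (Var 0)) (Var 0))
    (Ex 1 (exs 4 m (Conj transversal_fm (colouring_fm m j))))"

lemma sat_transversal_fm: "sat f v transversal_fm \<longleftrightarrow> transversal f (v 0) (v 1)"
  by (simp add: transversal_fm_def transversal_def)

lemma sat_colouring_fm:
  assumes "0 < m"
  shows "sat f v (colouring_fm m j) \<longleftrightarrow> colouring m j f (v 0) (v 1) (\<lambda>l. v (4 + l))"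
  by (auto simp: colouring_fm_def colouring_def)

lemma colouring_cong:
  assumes "0 < m" "\<And>l. l < m \<Longrightarrow> a l = b l"
  shows "colouring m j f x e a \<longleftrightarrow> colouring m j f x e b"
  using assms by (simp add: colouring_def)

lemma sat_coloured_fm:
  assumes "0 < m"
  shows "sat f v (coloured_fm m j) \<longleftrightarrow> coloured m j f (v 0)"
proof -
  \<comment> \<open>The quantifier block sets the first \<open>m\<close> values and keeps those of
    \<open>u\<close> beyond; \<open>colouring\<close> reads only the first \<open>m\<close>, since
    indices modulo \<open>m\<close> stay below \<open>m\<close>.\<close>
  have "(\<exists>a. colouring m j f x e (\<lambda>l. if l < m then a (4 + l - 4) else u l)) \<longleftrightarrow>
      (\<exists>a. colouring m j f x e a)" for x e u
    using assms colouring_cong[of m "\<lambda>l. if l < m then a (4 + l - 4) else u l" a j f x e for a]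
    by simp
  then show ?thesis
    using assms
    by (simp add: coloured_fm_def coloured_def sat_exs sat_transversal_fm sat_colouring_fm)
qed

lemma fv_coloured_fm:
  assumes "0 < m"
  shows "fv (coloured_fm m j) \<subseteq> {0}"
  using assms
  by (auto simp: coloured_fm_def transversal_fm_def colouring_fm_def split: if_splits)

theorem theorem5p5:
  fixes m j :: nat
  assumes "j < m"
  shows "\<exists>\<phi> \<psi>. sentence \<phi> \<and> sentence \<psi> \<and>
    (\<forall>n :: nat \<Rightarrow> nat. (\<forall>k. 0 < n k) \<longrightarrow>
      (models (rot_aut n) \<phi> \<longleftrightarrow> (\<forall>\<^sub>\<infinity>k. [n k = j] (mod m))) \<and>
      (models (rot_aut n) \<psi> \<longleftrightarrow> (\<exists>\<^sub>\<infinity>k. [n k = j] (mod m))))"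
proof (intro exI conjI allI impI)
  let ?\<phi> = "Ex 0 (Conj (Eq (Var 0) One) (coloured_fm m j))"
  let ?\<psi> = "Ex 0 (Conj (Neg (Eq (Var 0) Zero)) (coloured_fm m j))"
  have "0 < m" using assms by simp
  show "sentence ?\<phi>" "sentence ?\<psi>"
    using fv_coloured_fm[OF \<open>0 < m\<close>, of j] by (auto simp: sentence_def)
  fix n :: "nat \<Rightarrow> nat" assume "\<forall>k. 0 < n k"
  then have pos: "\<And>k. 0 < n k" by blast
  show "models (rot_aut n) ?\<phi> \<longleftrightarrow> (\<forall>\<^sub>\<infinity>k. [n k = j] (mod m))"
    using coloured_top_iff[of n, OF pos assms]
    by (simp add: models_def sat_coloured_fm[OF \<open>0 < m\<close>])
  show "models (rot_aut n) ?\<psi> \<longleftrightarrow> (\<exists>\<^sub>\<infinity>k. [n k = j] (mod m))"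
    using coloured_nonzero_iff[of n, OF pos assms]
    by (simp add: models_def sat_coloured_fm[OF \<open>0 < m\<close>])
qed

end
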